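(* Let $\alpha,\beta$ be real numbers with $0\leq\alpha\leq 3$ and $0\leq\beta\leq 3$. If $$\left(\frac{\tan x}{x}\right)^\alpha\leq \frac{3(\tan x-x)}{x^3}\leq \left(\frac{\tan x}{x}\right)^\beta$$ for every $x\in(0,\pi/2)$, then $\alpha\leq1$ and $\beta\geq 6/5$.
   Context: Powers are real powers of positive real numbers. *)

theory Defs
  imports Complex_Main
begin

end

theory Submission
  imports Defs "HOL-Real_Asymp.Real_Asymp"
begin

text \<open>
  The two bounds on the exponents come from the two ends of the interval. Write
  \<open>t = tan x / x\<close> and \<open>f = 3 * (tan x - x) / x ^ 3\<close>.

  As \<open>x\<close> approaches \<open>pi / 2\<close>, \<open>t\<close> tends to infinity while \<open>f < (3 / x\<^sup>2) * t\<close> grows only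
  linearly in \<open>t\<close>, so no power \<open>t powr \<alpha>\<close> with \<open>\<alpha> > 1\<close> can stay below \<open>f\<close>.

  As \<open>x\<close> approaches \<open>0\<close>, both quantities tend to \<open>1\<close>, with \<open>t = 1 + x\<^sup>2 / 3 + O(x ^ 4)\<close> and
  \<open>f = 1 + 2 * x\<^sup>2 / 5 + O(x ^ 4)\<close>. Hence \<open>ln f / ln t\<close> tends to \<open>(2 / 5) / (1 / 3) = 6 / 5\<close>,
  whereas \<open>f \<le> t powr \<beta>\<close> bounds this quotient by \<open>\<beta>\<close>.
\<close>

lemma lower_exponent_le_1:
  fixes \<alpha> :: real
  assumes "eventually (\<lambda>x. (tan x / x) powr \<alpha> \<le> 3 * (tan x - x) / x ^ 3) (at_left (pi / 2))"
  shows "\<alpha> \<le> 1"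
proof (rule ccontr)
  assume "\<not> \<alpha> \<le> 1"
  then have "\<alpha> - 1 > 0" by simp
  have "((\<lambda>x::real. inverse x) \<longlongrightarrow> inverse (pi / 2)) (at_left (pi / 2))"
    by (intro tendsto_inverse tendsto_ident_at) auto
  then have "filterlim (\<lambda>x::real. inverse x * tan x) at_top (at_left (pi / 2))"
    by (rule filterlim_tendsto_pos_mult_at_top) (auto intro: filterlim_tan_at_left)
  then have ratio_at_top: "filterlim (\<lambda>x::real. tan x / x) at_top (at_left (pi / 2))"
    by (simp add: field_simps)
  have "filterlim (\<lambda>t::real. t powr (\<alpha> - 1)) at_top at_top"
    using \<open>\<alpha> - 1 > 0\<close> by real_asymp
  from filterlim_compose[OF this ratio_at_top]
  have "eventually (\<lambda>x. (tan x / x) powr (\<alpha> - 1) > 12) (at_left (pi / 2))"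
    by (simp add: filterlim_at_top_dense)
  moreover have "eventually (\<lambda>x. tan x / x > 0) (at_left (pi / 2))"
    using ratio_at_top by (simp add: filterlim_at_top_dense)
  \<comment> \<open>Beyond \<open>x = 1 / 2\<close> the factor \<open>3 / x\<^sup>2\<close> is at most \<open>12\<close>, which makes the bound uniform.\<close>
  moreover have "eventually (\<lambda>x::real. x > 1 / 2) (at_left (pi / 2))"
    using pi_ge_two by (intro eventually_at_leftI[of "1 / 2"]) auto
  ultimately have "eventually (\<lambda>x::real. False) (at_left (pi / 2))"
    using assms
  proof eventually_elim
    case (elim x)
    define t where "t = tan x / x"
    have "t > 0" and "x > 1 / 2" using elim by (auto simp: t_def)
    have "12 * t < t powr (\<alpha> - 1) * t"
      using elim(1) \<open>t > 0\<close> unfolding t_def by (rule mult_strict_right_mono)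
    also have "\<dots> = t powr \<alpha>"
      using \<open>t > 0\<close> by (simp add: powr_diff)
    also have "\<dots> \<le> 3 * (tan x - x) / x ^ 3"
      using elim by (simp add: t_def)
    also have "\<dots> = 3 * (t - 1) / x\<^sup>2"
      using \<open>x > 1 / 2\<close> by (simp add: t_def field_simps power2_eq_square power3_eq_cube)
    also have "\<dots> \<le> 3 * t / x\<^sup>2"
      by (intro divide_right_mono) auto
    also have "\<dots> \<le> 3 * t / (1 / 2)\<^sup>2"
      using \<open>t > 0\<close> \<open>x > 1 / 2\<close> by (intro divide_left_mono power_mono) auto
    finally show False by (simp add: power2_eq_square)
  qed
  then show False
    by (simp add: trivial_limit_at_left_real)
qed

lemma upper_exponent_ge_6_5:
  fixes \<beta> :: real
  assumes "eventually (\<lambda>x. 3 * (tan x - x) / x ^ 3 \<le> (tan x / x) powr \<beta>) (at_right 0)"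
  shows "\<beta> \<ge> 6 / 5"
proof (rule tendsto_upperbound)
  show "((\<lambda>x::real. ln (3 * (tan x - x) / x ^ 3) / ln (tan x / x)) \<longlongrightarrow> 6 / 5) (at_right 0)"
    by real_asymp
  have "eventually (\<lambda>x::real. tan x / x > 1) (at_right 0)"
    by real_asymp
  moreover have "eventually (\<lambda>x::real. 3 * (tan x - x) / x ^ 3 > 0) (at_right 0)"
    by real_asymp
  ultimately show "eventually (\<lambda>x. ln (3 * (tan x - x) / x ^ 3) / ln (tan x / x) \<le> \<beta>) (at_right 0)"
    using assms
  proof eventually_elim
    case (elim x)
    then have "ln (3 * (tan x - x) / x ^ 3) \<le> ln ((tan x / x) powr \<beta>)"
      by (intro ln_mono) auto
    also have "\<dots> = \<beta> * ln (tan x / x)"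
      using elim by (simp add: ln_powr)
    finally show ?case
      using elim(1) by (subst pos_divide_le_eq) (auto intro: ln_gt_zero)
  qed
qed simp

theorem proposition2:
  fixes \<alpha> \<beta> :: real
  assumes "0 \<le> \<alpha>" and "\<alpha> \<le> 3"
    and "0 \<le> \<beta>" and "\<beta> \<le> 3"
    and "\<And>x::real. x \<in> {0<..<pi/2} \<Longrightarrow>
           (tan x / x) powr \<alpha> \<le> 3 * (tan x - x) / x ^ 3 \<and>
           3 * (tan x - x) / x ^ 3 \<le> (tan x / x) powr \<beta>"
  shows "\<alpha> \<le> 1 \<and> \<beta> \<ge> 6 / 5"
proof
  show "\<alpha> \<le> 1"
    using assms(5) by (intro lower_exponent_le_1 eventually_at_leftI[of 0]) auto
  show "\<beta> \<ge> 6 / 5"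
    using assms(5) by (intro upper_exponent_ge_6_5 eventually_at_rightI[of 0 "pi / 2"]) auto
qed

end
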